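(* Let $(X,\mathscr{R})$ be a symmetric association scheme with $n$ classes which is $Q$-polynomial with respect to the ordering $E_0,\dots,E_n$ of its primitive idempotents, fix a base vertex $x\in X$, and let $(Y,\omega)$ be a tight relative $2e$-design ($e$ a positive integer) supported on $\bigsqcup_{\ell\in L}X_\ell$. Let $\ell\in L$. If $X_\ell$ is a fiber of the coherent closure of the Terwilliger algebra $\bm{T}=\bm{T}(x)$, then $\omega$ is constant on $Y\cap X_\ell$.
   Context: A (symmetric) association scheme with $n$ classes is a finite set $X$ with a partition $X^2=R_0\sqcup\cdots\sqcup R_n$ into nonempty symmetric relations, $R_0$ the diagonal, such that for all $i,j,k$ and $(y,z)\in R_k$ the number of $w$ with $(y,w)\in R_i$, $(w,z)\in R_j$ depends only on $i,j,k$. With $A_i$ the adjacency matrix of $R_i$, the adjacency algebra $\bm{A}=\operatorname{span}\{A_i\}$ is commutative with primitive idempotents $E_0=|X|^{-1}J,E_1,\dots,E_n$. The scheme is $Q$-polynomial w.r.t. this ordering if there are reals $a_i^*,b_i^*,c_i^*$ with $b_n^*=c_0^*=0$, $b_{i-1}^*c_i^*\ne0$ and $E_1\circ E_i=|X|^{-1}(b_{i-1}^*E_{i-1}+a_i^*E_i+c_{i+1}^*E_{i+1})$ ($\circ$ entrywise product, $E_{-1}=E_{n+1}=O$). Let $V=\mathbb{C}^X$. For the base vertex $x$: $X_i=\{y:(x,y)\in R_i\}$, $E_i^*$ the diagonal 0/1 matrix with $(E_i^* )_{y,y}=1$ iff $y\in X_i$, $\hat x$ the characteristic vector of $x$. The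 Terwilliger algebra $\bm{T}(x)$ is the subalgebra of $M_X(\mathbb{C})$ generated by the $A_i$ and the $E_i^*$. A coherent algebra is a subalgebra of $M_X(\mathbb{C})$ containing the all-ones matrix $J$ and closed under entrywise product and conjugate transpose; the coherent closure of a set of matrices is the smallest coherent algebra containing it. A coherent algebra has a unique basis of 0/1 matrices $A_R$ indexed by a partition $\mathscr{S}$ of $X^2$; its fibers are the sets $\Phi$ with $\{(y,y):y\in\Phi\}\in\mathscr{S}$. A weighted subset is $(Y,\omega)$ with $\omega:X\to[0,\infty)$, $Y=\{y:\omega(y)>0\}$, supported on $\bigsqcup_{\ell\in L}X_\ell$ with $L=\{\ell: Y\cap X_\ell\ne\emptyset\}$; it is a relative $t$-design if $E_i\omega\in\operatorname{span}\{E_i\hat x\}$ for $1\le i\le t$. A relative $2e$-design satisfies $|Y|\ge\dim(\sum_{\ell\in L}E_\ell^* )(\sum_{i=0}^eE_iV)$ and is called tight if equality holds. *)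

theory Defs
  imports "HOL-Analysis.Analysis"
begin

text \<open>The vertex set \<open>X\<close> is the finite type \<open>'x\<close>, so that \<open>complex ^ 'x\<close> is \<open>V\<close> and
  \<open>complex ^ 'x ^ 'x\<close> is \<open>M\<^sub>X(\<complex>)\<close> (first index: row).\<close>

type_synonym 'x cmatrix = "complex ^ 'x ^ 'x"

text \<open>On \<open>complex ^ 'x ^ 'x\<close> the library scaling \<open>*s\<close> takes its scalars from \<open>complex ^ 'x\<close>,
  hence a separate scaling by complex numbers.\<close>

definition mscale :: "complex \<Rightarrow> 'x::finite cmatrix \<Rightarrow> 'x cmatrix" where
  "mscale c M = (\<chi> y z. c * M $ y $ z)"

interpretation cmat: vector_space "mscale :: complex \<Rightarrow> 'x::finite cmatrix \<Rightarrow> 'x cmatrix"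
  by unfold_locales (simp_all add: mscale_def vec_eq_iff algebra_simps)

definition hadamard :: "'x::finite cmatrix \<Rightarrow> 'x cmatrix \<Rightarrow> 'x cmatrix" where
  "hadamard M N = (\<chi> y z. M $ y $ z * N $ y $ z)"

definition conj_transpose :: "'x::finite cmatrix \<Rightarrow> 'x cmatrix" where
  "conj_transpose M = (\<chi> y z. cnj (M $ z $ y))"

definition all_ones :: "'x::finite cmatrix" where
  "all_ones = (\<chi> y z. 1)"

definition adj_matrix :: "('x::finite \<times> 'x) set \<Rightarrow> 'x cmatrix" where
  "adj_matrix r = (\<chi> y z. of_bool ((y, z) \<in> r))"

definition association_scheme :: "nat \<Rightarrow> (nat \<Rightarrow> ('x::finite \<times> 'x) set) \<Rightarrow> bool" where
  "association_scheme n R \<longleftrightarrow>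
     (\<Union>i\<le>n. R i) = UNIV \<and> disjoint_family_on R {..n} \<and>
     (\<forall>i\<le>n. R i \<noteq> {} \<and> sym (R i)) \<and> R 0 = Id \<and>
     (\<forall>i\<le>n. \<forall>j\<le>n. \<forall>k\<le>n. \<exists>p. \<forall>(y, z)\<in>R k.
        card {w. (y, w) \<in> R i \<and> (w, z) \<in> R j} = p)"

definition adjacency_algebra :: "nat \<Rightarrow> (nat \<Rightarrow> ('x::finite \<times> 'x) set) \<Rightarrow> 'x cmatrix set" where
  "adjacency_algebra n R = cmat.span ((\<lambda>i. adj_matrix (R i)) ` {..n})"

definition primitive_idempotent :: "'x::finite cmatrix set \<Rightarrow> 'x cmatrix \<Rightarrow> bool" where
  "primitive_idempotent \<A> P \<longleftrightarrow>
     P \<in> \<A> \<and> P \<noteq> 0 \<and> P ** P = P \<and>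
     \<not> (\<exists>F\<in>\<A>. \<exists>G\<in>\<A>. F \<noteq> 0 \<and> G \<noteq> 0 \<and> F ** F = F \<and> G ** G = G \<and>
          F ** G = 0 \<and> G ** F = 0 \<and> P = F + G)"

text \<open>\<open>E 0, \<dots>, E n\<close> enumerates the primitive idempotents of the adjacency algebra without
  repetition. The last conjunct is the convention \<open>E i = O\<close> beyond the index \<open>n\<close>.\<close>

definition idempotent_ordering ::
    "nat \<Rightarrow> (nat \<Rightarrow> ('x::finite \<times> 'x) set) \<Rightarrow> (nat \<Rightarrow> 'x cmatrix) \<Rightarrow> bool" where
  "idempotent_ordering n R E \<longleftrightarrow>
     bij_betw E {..n} {P. primitive_idempotent (adjacency_algebra n R) P} \<and>
     E 0 = mscale (1 / of_nat CARD('x)) all_ones \<and>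
     (\<forall>i>n. E i = 0)"

text \<open>The term with \<open>E\<close> of index \<open>-1\<close> is the zero matrix in the conditional below; the value
  \<open>c (n + 1)\<close> is irrelevant as \<open>E (n + 1) = 0\<close>.\<close>

definition Q_polynomial ::
    "nat \<Rightarrow> (nat \<Rightarrow> ('x::finite \<times> 'x) set) \<Rightarrow> (nat \<Rightarrow> 'x cmatrix) \<Rightarrow> bool" where
  "Q_polynomial n R E \<longleftrightarrow>
     idempotent_ordering n R E \<and>
     (\<exists>a b c :: nat \<Rightarrow> real.
        b n = 0 \<and> c 0 = 0 \<and> (\<forall>i\<in>{1..n}. b (i - 1) * c i \<noteq> 0) \<and>
        (\<forall>i\<le>n. hadamard (E 1) (E i) =
           mscale (1 / of_nat CARD('x))
             ((if i = 0 then 0 else mscale (of_real (b (i - 1))) (E (i - 1))) +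
              mscale (of_real (a i)) (E i) +
              mscale (of_real (c (i + 1))) (E (i + 1)))))"

definition shell :: "(nat \<Rightarrow> ('x::finite \<times> 'x) set) \<Rightarrow> 'x \<Rightarrow> nat \<Rightarrow> 'x set" where
  "shell R x i = {y. (x, y) \<in> R i}"

definition dual_idempotent :: "(nat \<Rightarrow> ('x::finite \<times> 'x) set) \<Rightarrow> 'x \<Rightarrow> nat \<Rightarrow> 'x cmatrix" where
  "dual_idempotent R x i = (\<chi> y z. of_bool (y = z \<and> y \<in> shell R x i))"

definition matrix_subalgebra :: "'x::finite cmatrix set \<Rightarrow> bool" where
  "matrix_subalgebra \<A> \<longleftrightarrow>
     cmat.subspace \<A> \<and> mat 1 \<in> \<A> \<and> (\<forall>M\<in>\<A>. \<forall>N\<in>\<A>. M ** N \<in> \<A>)"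

definition terwilliger_algebra ::
    "nat \<Rightarrow> (nat \<Rightarrow> ('x::finite \<times> 'x) set) \<Rightarrow> 'x \<Rightarrow> 'x cmatrix set" where
  "terwilliger_algebra n R x =
     matrix_subalgebra hull
       ((\<lambda>i. adj_matrix (R i)) ` {..n} \<union> dual_idempotent R x ` {..n})"

definition coherent_algebra :: "'x::finite cmatrix set \<Rightarrow> bool" where
  "coherent_algebra \<C> \<longleftrightarrow>
     matrix_subalgebra \<C> \<and> all_ones \<in> \<C> \<and>
     (\<forall>M\<in>\<C>. \<forall>N\<in>\<C>. hadamard M N \<in> \<C>) \<and> (\<forall>M\<in>\<C>. conj_transpose M \<in> \<C>)"

definition coherent_closure :: "'x::finite cmatrix set \<Rightarrow> 'x cmatrix set" where
  "coherent_closure S = coherent_algebra hull S"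

text \<open>The partition \<open>\<S>\<close> of \<open>X\<^sup>2\<close> whose adjacency matrices form a basis of \<open>\<C>\<close>; for a coherent
  algebra it exists and is unique, so the existential quantifier in \<open>is_fiber\<close> is harmless.\<close>

definition coherent_partition :: "'x::finite cmatrix set \<Rightarrow> ('x \<times> 'x) set set \<Rightarrow> bool" where
  "coherent_partition \<C> \<S> \<longleftrightarrow>
     partition_on UNIV \<S> \<and> cmat.independent (adj_matrix ` \<S>) \<and>
     cmat.span (adj_matrix ` \<S>) = \<C>"

definition is_fiber :: "'x::finite cmatrix set \<Rightarrow> 'x set \<Rightarrow> bool" where
  "is_fiber \<C> \<Phi> \<longleftrightarrow> (\<exists>\<S>. coherent_partition \<C> \<S> \<and> Id_on \<Phi> \<in> \<S>)"

definition weighted_subset :: "'x::finite set \<Rightarrow> ('x \<Rightarrow> real) \<Rightarrow> bool" where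
  "weighted_subset Y \<omega> \<longleftrightarrow> (\<forall>y. 0 \<le> \<omega> y) \<and> Y = {y. 0 < \<omega> y}"

definition support_indices ::
    "nat \<Rightarrow> (nat \<Rightarrow> ('x::finite \<times> 'x) set) \<Rightarrow> 'x \<Rightarrow> 'x set \<Rightarrow> nat set" where
  "support_indices n R x Y = {l. l \<le> n \<and> Y \<inter> shell R x l \<noteq> {}}"

definition relative_design ::
    "(nat \<Rightarrow> 'x::finite cmatrix) \<Rightarrow> 'x \<Rightarrow> nat \<Rightarrow> 'x set \<Rightarrow> ('x \<Rightarrow> real) \<Rightarrow> bool" where
  "relative_design E x t Y \<omega> \<longleftrightarrow>
     weighted_subset Y \<omega> \<and>
     (\<forall>i\<in>{1..t}. E i *v (\<chi> y. of_real (\<omega> y)) \<in> vec.span {E i *v axis x 1})"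

text \<open>\<open>vec.dim\<close> is the dimension over \<open>complex\<close>; the range inside it is the sum of the
  subspaces \<open>E 0 V, \<dots>, E e V\<close>.\<close>

definition tight_relative_design ::
    "nat \<Rightarrow> (nat \<Rightarrow> ('x::finite \<times> 'x) set) \<Rightarrow> (nat \<Rightarrow> 'x cmatrix) \<Rightarrow> 'x \<Rightarrow> nat \<Rightarrow>
     'x set \<Rightarrow> ('x \<Rightarrow> real) \<Rightarrow> bool" where
  "tight_relative_design n R E x e Y \<omega> \<longleftrightarrow>
     relative_design E x (2 * e) Y \<omega> \<and>
     card Y = vec.dim
       ((*v) (\<Sum>l\<in>support_indices n R x Y. dual_idempotent R x l) `
          range (\<lambda>v :: nat \<Rightarrow> complex ^ 'x. \<Sum>i\<le>e. E i *v v i))"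

end

theory Submission imports Defs
begin

text \<open>Let \<open>\<omega>'\<close> be the average of \<open>\<omega>\<close> over the shells and let \<open>W\<close> be the sum of the spaces \<open>E\<^sub>0V\<close>, ..., \<open>E\<^sub>eV\<close>.
  Products of two functions in \<open>W\<close> lie in \<open>E\<^sub>0V + ... + E\<^sub>2\<^sub>eV\<close>, so the design property says that
  \<open>\<omega>\<close> and \<open>\<omega>'\<close> define the same bilinear form on \<open>W\<close>. By tightness every function on \<open>Y\<close> is the restriction
  of one in \<open>W\<close>; testing the reproducing kernel \<open>K\<close> of \<open>W\<close> for \<open>\<omega>'\<close> against the function
  that is 1 at \<open>y\<close> and 0 elsewhere on \<open>Y\<close> gives \<open>\<omega>(y)K(y,y) = 1\<close>. Since \<open>\<omega>'\<close> is constant on shells,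
  \<open>K\<close> lies in the Terwilliger algebra, so its diagonal is constant on fibers of the coherent closure.\<close>

section \<open>Complex matrices\<close>

lemma mscale_nth [simp]: "mscale c M $ i $ j = c * M $ i $ j"
  by (simp add: mscale_def)

lemma matrix_mult_nth: "(M ** N) $ i $ j = (\<Sum>k\<in>UNIV. M $ i $ k * N $ k $ j)"
  by (simp add: matrix_matrix_mult_def)

lemma matrix_vector_nth: "(M *v v) $ i = (\<Sum>j\<in>UNIV. M $ i $ j * v $ j)"
  by (simp add: matrix_vector_mult_def)

lemma conj_transpose_nth [simp]: "conj_transpose M $ i $ j = cnj (M $ j $ i)"
  by (simp add: conj_transpose_def)

lemma hadamard_nth [simp]: "hadamard M N $ i $ j = M $ i $ j * N $ i $ j"
  by (simp add: hadamard_def)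

lemma mscale_mult_left: "mscale c M ** N = mscale c (M ** N)"
  by (simp add: vec_eq_iff matrix_mult_nth sum_distrib_left mult.assoc)

lemma mscale_mult_right: "M ** mscale c N = mscale c (M ** N)"
  by (simp add: vec_eq_iff matrix_mult_nth sum_distrib_left mult.left_commute)

lemma matrix_diff_ldistrib: "(M :: 'x::finite cmatrix) ** (N - P) = M ** N - M ** P"
  by (simp add: vec_eq_iff matrix_mult_nth sum_subtractf algebra_simps)

lemma matrix_diff_rdistrib: "((N :: 'x::finite cmatrix) - P) ** M = N ** M - P ** M"
  by (simp add: vec_eq_iff matrix_mult_nth sum_subtractf algebra_simps)

lemma matrix_mult_zero_right: "(M :: 'x::finite cmatrix) ** 0 = 0"
  by (simp add: vec_eq_iff matrix_mult_nth)

lemma matrix_add_rdistrib: "((N :: 'x::finite cmatrix) + P) ** M = N ** M + P ** M"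
  by (simp add: vec_eq_iff matrix_mult_nth distrib_right sum.distrib)

lemma matrix_mult_zero_left: "(0 :: 'x cmatrix) ** (M :: 'x::finite cmatrix) = 0"
  by (simp add: vec_eq_iff matrix_mult_nth)

lemma matrix_sum_right: "(M :: 'x::finite cmatrix) ** (\<Sum>i\<in>I. F i) = (\<Sum>i\<in>I. M ** F i)"
  by (induction I rule: infinite_finite_induct) (simp_all add: matrix_add_ldistrib)

lemma matrix_sum_left: "(\<Sum>i\<in>I. F i :: 'x::finite cmatrix) ** (M :: 'x cmatrix) = (\<Sum>i\<in>I. F i ** M)"
  by (induction I rule: infinite_finite_induct) (simp_all add: matrix_add_rdistrib matrix_mult_zero_left)

lemma matrix_vector_sum_left:
  "(\<Sum>i\<in>I. F i) *v v = (\<Sum>i\<in>I. (F i :: 'x::finite cmatrix) *v v)"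
  by (induction I rule: infinite_finite_induct) (simp_all add: matrix_vector_mult_add_rdistrib)

lemma conj_transpose_mult: "conj_transpose (M ** N) = conj_transpose N ** conj_transpose M"
  by (simp add: vec_eq_iff matrix_mult_nth mult.commute)

lemma conj_transpose_involutive [simp]: "conj_transpose (conj_transpose M) = M"
  by (simp add: vec_eq_iff)

lemma conj_transpose_sum: "conj_transpose (\<Sum>i\<in>I. F i) = (\<Sum>i\<in>I. conj_transpose (F i))"
  by (simp add: vec_eq_iff)

text \<open>The diagonal entries of the product are the squared norms of the columns of
  \<open>N\<close>.\<close>

lemma conj_transpose_mult_self_eq_0:
  assumes "conj_transpose N ** N = 0"
  shows "N = 0"
proof -
  have "N $ i $ j = 0" for i j
  proof -
    have "0 = (conj_transpose N ** N) $ j $ j"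
      using assms by simp
    also have "\<dots> = of_real (\<Sum>k\<in>UNIV. (cmod (N $ k $ j))\<^sup>2)"
      by (simp add: matrix_mult_nth complex_norm_square mult.commute del: of_real_power)
    finally have "(\<Sum>k\<in>UNIV. (cmod (N $ k $ j))\<^sup>2) = 0"
      by (metis of_real_eq_0_iff)
    then show ?thesis
      by (simp add: sum_nonneg_eq_0_iff)
  qed
  then show ?thesis by (simp add: vec_eq_iff)
qed

text \<open>With \<open>Q\<close> the conjugate transpose of \<open>P\<close> and
  \<open>F = P - Q ** P\<close>, normality gives \<open>conj_transpose F ** F = 0\<close>. Hence
  \<open>P = Q ** P\<close>, and the right-hand side is Hermitian.\<close>

lemma normal_idempotent_hermitian:
  assumes "P ** P = P" and "P ** conj_transpose P = conj_transpose P ** P"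
  shows "conj_transpose P = P"
proof -
  let ?Q = "conj_transpose P"
  let ?F = "P - ?Q ** P"
  have Q: "?Q ** ?Q = ?Q"
    by (metis assms(1) conj_transpose_mult)
  have "conj_transpose ?F = ?Q - ?Q ** P"
    by (simp add: vec_eq_iff conj_transpose_mult matrix_mult_nth mult.commute)
  then have "conj_transpose ?F ** ?F = (?Q - ?Q ** P) ** (P - ?Q ** P)"
    by simp
  also have "\<dots> = 0"
    by (simp add: matrix_diff_ldistrib matrix_diff_rdistrib)
      (metis Q assms matrix_mul_assoc)
  finally have "P = ?Q ** P"
    using conj_transpose_mult_self_eq_0 by force
  then show ?thesis
    by (metis conj_transpose_involutive conj_transpose_mult)
qed

lemma scaleR_eq_mscale: "r *\<^sub>R (M :: 'x::finite cmatrix) = mscale (of_real r) M"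
  by (simp add: vec_eq_iff scaleR_conv_of_real[where 'a=complex])

text \<open>Left multiplication by \<open>G\<close> is injective, hence bijective, on \<open>G\<C>\<close> because \<open>G\<close> is Hermitian.
  This gives \<open>G = G\<^sup>2X\<close>, and \<open>GX\<close> turns out to be the Hermitian projection onto the range of \<open>G\<close>.\<close>

lemma hermitian_regular:
  fixes \<C> :: "'x::finite cmatrix set"
  assumes C: "matrix_subalgebra \<C>" and G: "G \<in> \<C>" and herm: "conj_transpose G = G"
  obtains X where "X \<in> \<C>" and "G ** X ** G = G"
proof -
  let ?S = "(**) G ` \<C>"
  \<comment> \<open>Dimensions are counted over the reals: every complex subspace is a real subspace
    of the finite-dimensional matrix space.\<close>
  have lin: "linear ((**) G :: 'x cmatrix \<Rightarrow> 'x cmatrix)"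
    by (rule linearI) (simp_all add: matrix_add_ldistrib scaleR_eq_mscale mscale_mult_right)
  have csub: "cmat.subspace \<C>" and one: "mat 1 \<in> \<C>" and mult: "\<And>M N. M \<in> \<C> \<Longrightarrow> N \<in> \<C> \<Longrightarrow> M ** N \<in> \<C>"
    using C by (auto simp: matrix_subalgebra_def)
  have "subspace \<C>"
    using csub by (auto simp: subspace_def scaleR_eq_mscale cmat.subspace_def)
  then have S: "subspace ?S"
    using lin by (rule linear_subspace_image[rotated])
  have inj: "inj_on ((**) G) ?S"
    unfolding linear_injective_on_subspace_0[OF lin S]
  proof clarify
    fix M assume "M \<in> \<C>" "G ** (G ** M) = 0"
    then have "conj_transpose (G ** M) ** (G ** M) = 0"
      by (metis conj_transpose_mult herm matrix_mul_assoc matrix_mult_zero_right)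
    then show "G ** M = 0"
      by (rule conj_transpose_mult_self_eq_0)
  qed
  have "subspace ((**) G ` ?S)"
    using S lin by (rule linear_subspace_image[rotated])
  moreover have "(**) G ` ?S \<subseteq> ?S"
    using mult G by auto
  moreover have "dim ((**) G ` ?S) = dim ?S"
    by (rule dim_image_eq[OF lin]) (metis S inj span_eq_iff)
  ultimately have "(**) G ` ?S = ?S"
    using S by (intro subspace_dim_equal) auto
  moreover have "G \<in> ?S"
    using one by (metis image_eqI matrix_mul_rid)
  ultimately obtain X where X: "X \<in> \<C>" "G = G ** (G ** X)"
    by auto
  let ?P = "G ** X"
  \<comment> \<open>The adjoint of \<open>G = G ** (G ** X)\<close>. It yields
    \<open>conj_transpose ?P ** ?P = ?P\<close>, which makes \<open>?P\<close> Hermitian, and then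
    \<open>?P ** G = G\<close>.\<close>
  have GG: "G = conj_transpose X ** G ** G"
    by (metis X(2) conj_transpose_mult herm)
  have "conj_transpose ?P ** ?P = ?P"
    by (metis GG conj_transpose_mult herm matrix_mul_assoc)
  then have "conj_transpose ?P = ?P"
    by (metis conj_transpose_involutive conj_transpose_mult)
  then have "?P ** G = conj_transpose X ** G ** G"
    by (simp add: conj_transpose_mult herm)
  then have "?P ** G = G"
    using GG by simp
  then show thesis
    using X(1) that by blast
qed

text \<open>The squared moduli of these sums, added up over all \<open>a\<close>, \<open>y\<close>,
  \<open>z\<close>, collapse by the two projection identities to the trace of
  \<open>P ** hadamard N N\<close>, which is zero.\<close>

lemma triple_product_vanishes:
  fixes P N :: "'x::finite cmatrix"
  assumes P: "conj_transpose P ** P = P" and N: "N ** conj_transpose N = N"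
    and PN: "P ** hadamard N N = 0" and sym: "\<And>y z. N $ y $ z = N $ z $ y"
  shows "(\<Sum>w\<in>UNIV. P $ a $ w * N $ w $ y * N $ w $ z) = 0"
proof -
  define s where "s = (\<lambda>(a, y, z) w. P $ a $ w * N $ w $ y * N $ w $ z)"
  define t where "t q = (\<Sum>w\<in>UNIV. s q w)" for q
  have PP: "(\<Sum>a\<in>UNIV. cnj (P $ a $ w') * P $ a $ w) = P $ w' $ w" for w w'
    using arg_cong[OF P, of "\<lambda>A. A $ w' $ w"] by (simp add: matrix_mult_nth)
  have NN: "(\<Sum>y\<in>UNIV. cnj (N $ w' $ y) * N $ w $ y) = N $ w $ w'" for w w'
    using arg_cong[OF N, of "\<lambda>A. A $ w $ w'"] by (simp add: matrix_mult_nth mult.commute)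
  have triple: "(\<Sum>q\<in>UNIV. g q) = (\<Sum>a\<in>UNIV. \<Sum>y\<in>UNIV. \<Sum>z\<in>UNIV. g (a, y, z))"
    for g :: "'x \<times> 'x \<times> 'x \<Rightarrow> complex"
    by (simp add: sum.cartesian_product)
  have inner: "(\<Sum>q\<in>UNIV. cnj (s q w') * s q w) = P $ w' $ w * hadamard N N $ w $ w'" for w w'
  proof -
    have "(\<Sum>q\<in>UNIV. cnj (s q w') * s q w) = (\<Sum>a\<in>UNIV. \<Sum>y\<in>UNIV. \<Sum>z\<in>UNIV.
        (cnj (P $ a $ w') * P $ a $ w) * ((cnj (N $ w' $ y) * N $ w $ y) * (cnj (N $ w' $ z) * N $ w $ z)))"
      unfolding triple by (simp add: s_def mult_ac)
    also have "\<dots> = P $ w' $ w * (N $ w $ w' * N $ w $ w')"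
      by (simp add: sum_distrib_left[symmetric] sum_distrib_right[symmetric] PP NN)
    finally show ?thesis by simp
  qed
  have "(\<Sum>q\<in>UNIV. cnj (t q) * t q) = (\<Sum>q\<in>UNIV. \<Sum>w'\<in>UNIV. \<Sum>w\<in>UNIV. cnj (s q w') * s q w)"
    by (simp add: t_def sum_product)
  also have "\<dots> = (\<Sum>w'\<in>UNIV. \<Sum>w\<in>UNIV. \<Sum>q\<in>UNIV. cnj (s q w') * s q w)"
    by (subst sum.swap) (intro sum.cong refl sum.swap)
  also have "\<dots> = (\<Sum>w'\<in>UNIV. (P ** hadamard N N) $ w' $ w')"
    unfolding inner matrix_mult_nth ..
  finally have "(\<Sum>q\<in>UNIV. cnj (t q) * t q) = 0"
    by (simp add: PN)
  then have "complex_of_real (\<Sum>q\<in>UNIV. (cmod (t q))\<^sup>2) = 0"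
    by (simp add: complex_norm_square mult.commute del: of_real_power)
  then have "(\<Sum>q\<in>UNIV. (cmod (t q))\<^sup>2) = 0"
    by (metis of_real_eq_0_iff)
  then have "t (a, y, z) = 0"
    by (simp add: sum_nonneg_eq_0_iff)
  then show ?thesis by (simp add: t_def s_def)
qed

lemma sum_cnj_mult_self_eq_0:
  fixes f :: "'a::finite \<Rightarrow> complex"
  assumes "(\<Sum>y\<in>UNIV. of_real (w y) * (cnj (f y) * f y)) = 0" "\<And>y. 0 \<le> w y"
  shows "of_real (w y) * f y = 0"
proof -
  have "complex_of_real (\<Sum>y\<in>UNIV. w y * (cmod (f y))\<^sup>2) = 0"
    using assms(1) by (simp add: complex_norm_square mult.commute del: of_real_power)
  then have "(\<Sum>y\<in>UNIV. w y * (cmod (f y))\<^sup>2) = 0"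
    by (metis of_real_eq_0_iff)
  then show ?thesis
    using assms(2) by (simp add: sum_nonneg_eq_0_iff)
qed

lemma diagonal_mult_vec:
  fixes u :: "'a::comm_semiring_1 ^ 'x::finite"
  shows "(\<chi> y z. of_bool (y = z) * g y) *v u = (\<chi> y. g y * u $ y)"
  by (simp add: vec_eq_iff matrix_vector_nth mult.assoc)

section \<open>Coherent algebras\<close>

text \<open>By disjointness, the only relation of the partition that meets the diagonal over \<Phi>
  is \<open>Id_on \<Phi>\<close>. So each basis matrix has constant diagonal on \<Phi>, and this
  property passes to the span.\<close>

lemma fiber_constant_diagonal:
  assumes "is_fiber \<C> \<Phi>" "M \<in> \<C>" "y \<in> \<Phi>" "z \<in> \<Phi>"
  shows "M $ y $ y = M $ z $ z"
proof -
  obtain \<S> where part: "partition_on UNIV \<S>" and span: "cmat.span (adj_matrix ` \<S>) = \<C>"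
    and \<Phi>: "Id_on \<Phi> \<in> \<S>"
    using assms(1) by (auto simp: is_fiber_def coherent_partition_def)
  have "M \<in> cmat.span (adj_matrix ` \<S>)"
    using assms(2) span by simp
  then show ?thesis
  proof (rule cmat.span_induct)
    show "cmat.subspace {M. M $ y $ y = M $ z $ z}"
      by (simp add: cmat.subspace_def)
  next
    fix N assume "N \<in> adj_matrix ` \<S>"
    then obtain r where r: "r \<in> \<S>" "N = adj_matrix r"
      by auto
    have "(u, u) \<in> r \<longleftrightarrow> r = Id_on \<Phi>" if "u \<in> \<Phi>" for u
      using part r(1) \<Phi> that unfolding partition_on_def disjoint_def by blast
    then show "N $ y $ y = N $ z $ z"
      using r(2) assms(3,4) by (simp add: adj_matrix_def)
  qed
qed

lemma coherent_algebra_closure: "coherent_algebra (coherent_closure S)"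
  unfolding coherent_closure_def
  by (rule hull_in)
    (simp add: coherent_algebra_def matrix_subalgebra_def cmat.subspace_def Ball_def)

lemma generator_in_coherent_closure:
  assumes "M \<in> (\<lambda>i. adj_matrix (R i)) ` {..n} \<union> dual_idempotent R x ` {..n}"
  shows "M \<in> coherent_closure (terwilliger_algebra n R x)"
  using assms unfolding coherent_closure_def terwilliger_algebra_def by (intro hull_inc)

section \<open>The adjacency algebra\<close>

locale scheme =
  fixes n :: nat and R :: "nat \<Rightarrow> ('x::finite \<times> 'x) set"
  assumes scheme: "association_scheme n R"
begin

lemma relation_exists: "\<exists>k\<le>n. (y, z) \<in> R k"
  using scheme by (auto simp: association_scheme_def)

lemma relation_unique:
  assumes "i \<le> n" "j \<le> n" "(y, z) \<in> R i" "(y, z) \<in> R j"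
  shows "i = j"
proof (rule ccontr)
  assume "i \<noteq> j"
  then have "R i \<inter> R j = {}"
    using scheme assms by (auto simp: association_scheme_def disjoint_family_on_def)
  then show False using assms by blast
qed

lemma relation_sym: "i \<le> n \<Longrightarrow> (y, z) \<in> R i \<longleftrightarrow> (z, y) \<in> R i"
  using scheme by (auto simp: association_scheme_def sym_def)

lemma intersection_number:
  assumes "i \<le> n" "j \<le> n" "k \<le> n" "(y, z) \<in> R k" "(y', z') \<in> R k"
  shows "card {w. (y, w) \<in> R i \<and> (w, z) \<in> R j} = card {w. (y', w) \<in> R i \<and> (w, z') \<in> R j}"
proof -
  have "\<exists>p. \<forall>(y, z)\<in>R k. card {w. (y, w) \<in> R i \<and> (w, z) \<in> R j} = p"
    using scheme assms(1-3) by (simp add: association_scheme_def)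
  then obtain p where "\<And>y z. (y, z) \<in> R k \<Longrightarrow> card {w. (y, w) \<in> R i \<and> (w, z) \<in> R j} = p"
    by fast
  from this[OF assms(4)] this[OF assms(5)] show ?thesis by simp
qed

abbreviation "\<A> \<equiv> adjacency_algebra n R"

lemma subspace_adjacency_algebra: "cmat.subspace \<A>"
  by (simp add: adjacency_algebra_def)

lemma adj_matrix_in_adjacency_algebra: "i \<le> n \<Longrightarrow> adj_matrix (R i) \<in> \<A>"
  unfolding adjacency_algebra_def by (rule cmat.span_base) auto

lemma adjacency_algebra_induct [consumes 1, case_names subspace adj]:
  assumes "M \<in> \<A>" "cmat.subspace {M. P M}" "\<And>i. i \<le> n \<Longrightarrow> P (adj_matrix (R i))"
  shows "P M"
proof (rule cmat.span_induct[where P = P, OF _ assms(2)])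
  show "M \<in> cmat.span ((\<lambda>i. adj_matrix (R i)) ` {..n})"
    using assms(1) by (simp add: adjacency_algebra_def)
  show "P N" if "N \<in> (\<lambda>i. adj_matrix (R i)) ` {..n}" for N
    using that assms(3) by blast
qed

lemma adjacency_algebraI:
  assumes "\<And>k y z y' z'. k \<le> n \<Longrightarrow> (y, z) \<in> R k \<Longrightarrow> (y', z') \<in> R k \<Longrightarrow> M $ y $ z = M $ y' $ z'"
  shows "M \<in> \<A>"
proof -
  \<comment> \<open>The common value on \<open>R k\<close>, read off at an arbitrary pair.\<close>
  define f where "f k = (case SOME q. q \<in> R k of (y, z) \<Rightarrow> M $ y $ z)" for k
  have f: "M $ y $ z = f k" if "k \<le> n" "(y, z) \<in> R k" for k y z
    using assms[OF that] that(2) someI[of "\<lambda>q. q \<in> R k"]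
    unfolding f_def by (metis (mono_tags, lifting) case_prod_unfold prod.collapse)
  have "M $ y $ z = (\<Sum>k\<le>n. mscale (f k) (adj_matrix (R k))) $ y $ z" for y z
  proof -
    obtain k where k: "k \<le> n" "(y, z) \<in> R k"
      using relation_exists by blast
    have "(\<Sum>i\<le>n. f i * of_bool ((y, z) \<in> R i)) = (\<Sum>i\<le>n. if i = k then f k else 0)"
      using k relation_unique by (intro sum.cong) auto
    then show ?thesis
      using k f by (simp add: adj_matrix_def)
  qed
  then have "M = (\<Sum>k\<le>n. mscale (f k) (adj_matrix (R k)))"
    by (simp add: vec_eq_iff)
  also have "\<dots> \<in> \<A>"
    by (intro cmat.subspace_sum cmat.subspace_scale subspace_adjacency_algebra
        adj_matrix_in_adjacency_algebra) auto
  finally show ?thesis .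
qed

lemma adjacency_algebra_symmetric: "M \<in> \<A> \<Longrightarrow> M $ y $ z = M $ z $ y"
proof (induction rule: adjacency_algebra_induct)
  case subspace
  then show ?case by (simp add: cmat.subspace_def)
next
  case (adj i)
  then show ?case using relation_sym[of i y z] by (simp add: adj_matrix_def)
qed

lemma adjacency_algebra_conj_transpose: "M \<in> \<A> \<Longrightarrow> conj_transpose M \<in> \<A>"
proof (induction rule: adjacency_algebra_induct)
  case subspace
  have [simp]: "conj_transpose 0 = 0" "conj_transpose (M + N) = conj_transpose M + conj_transpose N"
    "conj_transpose (mscale c M) = mscale (cnj c) (conj_transpose M)" for c and M N :: "'x cmatrix"
    by (simp_all add: vec_eq_iff)
  show ?case
    using subspace_adjacency_algebra by (simp add: cmat.subspace_def)
next
  case (adj i)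
  have "conj_transpose (adj_matrix (R i)) = adj_matrix (R i)"
    using adj relation_sym[of i] by (auto simp: adj_matrix_def vec_eq_iff)
  then show ?case using adj adj_matrix_in_adjacency_algebra by simp
qed

text \<open>Bilinearity reduces the claim to two adjacency matrices. The entries of their product
  are intersection numbers, hence constant on every relation.\<close>

lemma adjacency_algebra_mult:
  assumes M: "M \<in> \<A>" and N: "N \<in> \<A>"
  shows "M ** N \<in> \<A>"
  using M
proof (induction rule: adjacency_algebra_induct)
  case subspace
  then show ?case
    using subspace_adjacency_algebra
    by (simp add: cmat.subspace_def mscale_mult_left matrix_add_rdistrib matrix_mult_zero_left)
next
  case (adj i)
  from N show ?case
  proof (induction rule: adjacency_algebra_induct)
    case subspace
    then show ?case
      using subspace_adjacency_algebra
      by (simp add: cmat.subspace_def mscale_mult_right matrix_add_ldistrib)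
  next
    case adj': (adj j)
    have eq: "(adj_matrix (R i) ** adj_matrix (R j)) $ y $ z
        = of_nat (card {w. (y, w) \<in> R i \<and> (w, z) \<in> R j})" for y z
      by (simp add: matrix_mult_nth adj_matrix_def flip: of_bool_conj)
    show ?case
    proof (rule adjacency_algebraI)
      fix k y z y' z' assume "k \<le> n" "(y, z) \<in> R k" "(y', z') \<in> R k"
      then show "(adj_matrix (R i) ** adj_matrix (R j)) $ y $ z = (adj_matrix (R i) ** adj_matrix (R j)) $ y' $ z'"
        unfolding eq by (intro arg_cong[where f = of_nat] intersection_number[OF adj adj'])
    qed
  qed
qed

text \<open>All members are symmetric, the product included, and transposing the product swaps its
  factors.\<close>

lemma adjacency_algebra_commute:
  assumes "M \<in> \<A>" "N \<in> \<A>"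
  shows "M ** N = N ** M"
proof -
  have "(M ** N) $ y $ z = (N ** M) $ y $ z" for y z
  proof -
    have "(M ** N) $ y $ z = (M ** N) $ z $ y"
      using adjacency_algebra_symmetric adjacency_algebra_mult[OF assms] by blast
    also have "\<dots> = (\<Sum>k\<in>UNIV. M $ k $ z * N $ y $ k)"
      unfolding matrix_mult_nth
      using adjacency_algebra_symmetric[OF assms(1)] adjacency_algebra_symmetric[OF assms(2)]
      by metis
    also have "\<dots> = (N ** M) $ y $ z"
      by (simp add: matrix_mult_nth mult.commute)
    finally show ?thesis .
  qed
  then show ?thesis by (simp add: vec_eq_iff)
qed

lemma one_in_adjacency_algebra: "mat 1 \<in> \<A>"
proof -
  have "R 0 = Id"
    using scheme by (simp add: association_scheme_def)
  then have "mat 1 = adj_matrix (R 0)"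
    by (auto simp: adj_matrix_def mat_def vec_eq_iff)
  then show ?thesis using adj_matrix_in_adjacency_algebra by simp
qed

section \<open>Idempotents of the adjacency algebra\<close>

lemma primitive_idempotent_hermitian:
  assumes "primitive_idempotent \<A> P"
  shows "conj_transpose P = P"
proof (rule normal_idempotent_hermitian)
  have P: "P \<in> \<A>"
    using assms by (simp add: primitive_idempotent_def)
  show "P ** P = P"
    using assms by (simp add: primitive_idempotent_def)
  \<comment> \<open>Commutativity makes every member of the algebra normal.\<close>
  show "P ** conj_transpose P = conj_transpose P ** P"
    by (intro adjacency_algebra_commute adjacency_algebra_conj_transpose P)
qed

lemma primitive_idempotent_real:
  assumes "primitive_idempotent \<A> P"
  shows "cnj (P $ y $ z) = P $ y $ z"
proof -
  have "cnj (P $ y $ z) = conj_transpose P $ z $ y"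
    by simp
  also have "\<dots> = P $ z $ y"
    using primitive_idempotent_hermitian[OF assms] by simp
  also have "\<dots> = P $ y $ z"
    using adjacency_algebra_symmetric assms by (auto simp: primitive_idempotent_def)
  finally show ?thesis .
qed

text \<open>Otherwise \<open>P\<close> would split into the nonzero orthogonal idempotents
  \<open>P ** Q\<close> and \<open>P - P ** Q\<close>, against primitivity.\<close>

lemma primitive_idempotent_absorb:
  assumes P: "primitive_idempotent \<A> P" and Q: "Q \<in> \<A>" "Q ** Q = Q" and nz: "P ** Q \<noteq> 0"
  shows "P ** Q = P"
proof (rule ccontr)
  assume neq: "P ** Q \<noteq> P"
  have PA: "P \<in> \<A>" and PP: "P ** P = P"
    using P by (auto simp: primitive_idempotent_def)
  let ?F = "P ** Q" and ?G = "P - P ** Q"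
  have comm: "P ** Q = Q ** P"
    using PA Q(1) by (rule adjacency_algebra_commute)
  have FF: "?F ** ?F = ?F"
    by (metis PP Q(2) comm matrix_mul_assoc)
  have PF: "P ** ?F = ?F" and FP: "?F ** P = ?F"
    by (metis PP matrix_mul_assoc, metis PP comm matrix_mul_assoc)
  have "?F \<in> \<A>" "?G \<in> \<A>"
    using PA Q(1) by (auto intro: adjacency_algebra_mult cmat.subspace_diff subspace_adjacency_algebra)
  moreover have "?G ** ?G = ?G" "?F ** ?G = 0" "?G ** ?F = 0"
    by (simp_all add: matrix_diff_ldistrib matrix_diff_rdistrib FF PF FP PP)
  moreover have "P = ?F + ?G" by simp
  moreover have "?G \<noteq> 0" using neq by simp
  ultimately show False
    using P FF nz unfolding primitive_idempotent_def by blast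
qed

text \<open>If the product were nonzero, each factor would absorb the other, so by commutativity
  both would equal the product.\<close>

lemma primitive_idempotent_orthogonal:
  assumes "primitive_idempotent \<A> P" "primitive_idempotent \<A> Q" "P \<noteq> Q"
  shows "P ** Q = 0"
proof (rule ccontr)
  assume nz: "P ** Q \<noteq> 0"
  have comm: "P ** Q = Q ** P"
    using assms by (intro adjacency_algebra_commute) (simp_all add: primitive_idempotent_def)
  have "P \<in> \<A>" "P ** P = P" "Q \<in> \<A>" "Q ** Q = Q"
    using assms by (simp_all add: primitive_idempotent_def)
  then have "P ** Q = P" "Q ** P = Q"
    using assms nz comm primitive_idempotent_absorb by metis+
  then show False using comm assms(3) by simp
qed

section \<open>Functions constant on the shells\<close>

text \<open>These vectors form the span of the characteristic vectors of the shells, the primary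
  module of the Terwilliger algebra.\<close>

definition shell_constant :: "'x \<Rightarrow> complex ^ 'x \<Rightarrow> bool" where
  "shell_constant x u \<longleftrightarrow> (\<forall>k\<le>n. \<forall>y\<in>shell R x k. \<forall>z\<in>shell R x k. u $ y = u $ z)"

lemma shell_constant_add: "shell_constant x u \<Longrightarrow> shell_constant x v \<Longrightarrow> shell_constant x (u + v)"
  unfolding shell_constant_def by (metis vector_add_component)

lemma shell_constant_scale: "shell_constant x u \<Longrightarrow> shell_constant x (c *s u)"
  unfolding shell_constant_def by (metis vector_smult_component)

lemma shell_exists: "\<exists>k\<le>n. y \<in> shell R x k"
  using relation_exists by (auto simp: shell_def)

lemma shell_unique: "i \<le> n \<Longrightarrow> j \<le> n \<Longrightarrow> y \<in> shell R x i \<Longrightarrow> y \<in> shell R x j \<Longrightarrow> i = j"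
  using relation_unique by (auto simp: shell_def)

lemma sum_over_shells: "(\<Sum>y\<in>UNIV. g y) = (\<Sum>k\<le>n. \<Sum>y\<in>shell R x k. g y)"
proof -
  have "(\<Union>k\<le>n. shell R x k) = UNIV"
    using shell_exists by auto
  moreover have "sum g (\<Union>k\<le>n. shell R x k) = (\<Sum>k\<le>n. \<Sum>y\<in>shell R x k. g y)"
    using shell_unique by (intro sum.UNION_disjoint) auto
  ultimately show ?thesis by simp
qed

lemma shell_constant_axis: "shell_constant x (axis x 1)"
proof -
  have "R 0 = Id"
    using scheme by (simp add: association_scheme_def)
  then have "k = 0" if "k \<le> n" "x \<in> shell R x k" for k
    using shell_unique[of k 0 x x] that by (simp add: shell_def)
  then show ?thesis
    using \<open>R 0 = Id\<close> by (fastforce simp: shell_constant_def axis_def shell_def)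
qed

text \<open>An entry of \<open>adj_matrix (R i) *v u\<close> is a combination of intersection
  numbers with the values of \<open>u\<close> on the shells as coefficients, so it depends only on
  the shell of the position.\<close>

lemma shell_constant_mult:
  assumes "M \<in> \<A>" and u: "shell_constant x u"
  shows "shell_constant x (M *v u)"
  using assms(1)
proof (induction rule: adjacency_algebra_induct)
  case subspace
  have [simp]: "mscale c M *v u = c *s (M *v u)" for c and M :: "'x cmatrix"
    by (simp add: vec_eq_iff matrix_vector_nth sum_distrib_left mult.assoc)
  have "shell_constant x 0"
    by (simp add: shell_constant_def)
  then show ?case
    by (intro cmat.subspaceI)
      (simp_all add: matrix_vector_mult_add_rdistrib shell_constant_add shell_constant_scale)
next
  case (adj i)
  \<comment> \<open>The value of \<open>u\<close> on shell \<open>m\<close>, arbitrary if that shell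
    is empty.\<close>
  define f where "f m = (SOME a. \<forall>z\<in>shell R x m. u $ z = a)" for m
  have f: "u $ z = f m" if "m \<le> n" "z \<in> shell R x m" for m z
  proof -
    have "\<exists>a. \<forall>z\<in>shell R x m. u $ z = a"
      using u that unfolding shell_constant_def by blast
    then have "\<forall>z\<in>shell R x m. u $ z = f m"
      unfolding f_def by (rule someI_ex)
    then show ?thesis using that by blast
  qed
  have eq: "(adj_matrix (R i) *v u) $ y
      = (\<Sum>m\<le>n. f m * of_nat (card {z. (x, z) \<in> R m \<and> (z, y) \<in> R i}))" for y
  proof -
    have "(adj_matrix (R i) *v u) $ y = (\<Sum>m\<le>n. \<Sum>z\<in>shell R x m. of_bool ((y, z) \<in> R i) * u $ z)"
      unfolding matrix_vector_nth sum_over_shells[where x = x] by (simp add: adj_matrix_def)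
    also have "\<dots> = (\<Sum>m\<le>n. \<Sum>z\<in>shell R x m. f m * of_bool ((z, y) \<in> R i))"
      by (intro sum.cong) (simp_all add: f relation_sym[OF adj, of y] mult.commute)
    also have "\<dots> = (\<Sum>m\<le>n. f m * of_nat (card {z. (x, z) \<in> R m \<and> (z, y) \<in> R i}))"
      by (simp add: shell_def Int_def flip: sum_distrib_left)
    finally show ?thesis .
  qed
  show ?case
    unfolding shell_constant_def
  proof (intro allI impI ballI)
    fix k y z assume "k \<le> n" "y \<in> shell R x k" "z \<in> shell R x k"
    then have "card {w. (x, w) \<in> R m \<and> (w, y) \<in> R i} = card {w. (x, w) \<in> R m \<and> (w, z) \<in> R i}"
      if "m \<le> n" for m
      unfolding shell_def by (intro intersection_number[OF that adj]) auto
    then show "(adj_matrix (R i) *v u) $ y = (adj_matrix (R i) *v u) $ z"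
      unfolding eq by (intro sum.cong) simp_all
  qed
qed

lemma shell_constant_diff: "shell_constant x u \<Longrightarrow> shell_constant x v \<Longrightarrow> shell_constant x (u - v)"
  unfolding shell_constant_def by (metis vector_minus_component)

lemma shell_constant_cnj: "shell_constant x u \<Longrightarrow> shell_constant x (\<chi> y. cnj (u $ y))"
  unfolding shell_constant_def by (metis vec_lambda_beta)

section \<open>Averages of a weight over the shells\<close>

definition shell_weight :: "'x \<Rightarrow> ('x \<Rightarrow> real) \<Rightarrow> nat \<Rightarrow> real" where
  "shell_weight x \<omega> k = (\<Sum>z\<in>shell R x k. \<omega> z) / card (shell R x k)"

text \<open>Written as a combination of indicators, so that the diagonal matrix of the average is
  visibly a combination of dual idempotents.\<close>

definition shell_average :: "'x \<Rightarrow> ('x \<Rightarrow> real) \<Rightarrow> 'x \<Rightarrow> real" where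
  "shell_average x \<omega> y = (\<Sum>k\<le>n. of_bool (y \<in> shell R x k) * shell_weight x \<omega> k)"

lemma shell_average_eq:
  assumes "k \<le> n" "y \<in> shell R x k"
  shows "shell_average x \<omega> y = shell_weight x \<omega> k"
proof -
  have "y \<in> shell R x i \<longleftrightarrow> i = k" if "i \<le> n" for i
    using shell_unique[OF that assms(1) _ assms(2)] assms(2) by blast
  then have "shell_average x \<omega> y = (\<Sum>i\<le>n. if i = k then shell_weight x \<omega> k else 0)"
    unfolding shell_average_def by (intro sum.cong) simp_all
  then show ?thesis using assms(1) by simp
qed

lemma shell_average_nonneg:
  assumes "\<And>y. 0 \<le> \<omega> y"
  shows "0 \<le> shell_average x \<omega> y"
  unfolding shell_average_def shell_weight_def
  by (intro sum_nonneg mult_nonneg_nonneg divide_nonneg_nonneg) (simp_all add: assms)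

lemma shell_average_pos:
  assumes "\<And>y. 0 \<le> \<omega> y" "k \<le> n" "y \<in> shell R x k" "z \<in> shell R x k" "0 < \<omega> z"
  shows "0 < shell_average x \<omega> y"
proof -
  have "0 < (\<Sum>z\<in>shell R x k. \<omega> z)"
    using assms by (intro sum_pos2[of _ z]) auto
  moreover have "0 < card (shell R x k)"
    using assms(3) by (auto simp: card_gt_0_iff)
  ultimately show ?thesis
    using assms(2,3) by (simp add: shell_average_eq shell_weight_def)
qed

lemma shell_constant_average: "shell_constant x (\<chi> y. of_real (shell_average x \<omega> y))"
  by (simp add: shell_constant_def shell_average_eq)

text \<open>On each shell \<open>u\<close> is a constant factor, and subtracting the average leaves
  total weight zero there.\<close>

lemma sum_shell_constant_average:
  assumes u: "shell_constant x u"
  shows "(\<Sum>y\<in>UNIV. u $ y * of_real (\<omega> y - shell_average x \<omega> y)) = 0"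
  unfolding sum_over_shells[where x = x]
proof (rule sum.neutral, rule ballI)
  fix k assume k: "k \<in> {..n}"
  show "(\<Sum>y\<in>shell R x k. u $ y * of_real (\<omega> y - shell_average x \<omega> y)) = 0"
  proof (cases "shell R x k = {}")
    case False
    then obtain z where z: "z \<in> shell R x k"
      by blast
    have "(\<Sum>y\<in>shell R x k. u $ y * of_real (\<omega> y - shell_average x \<omega> y))
        = (\<Sum>y\<in>shell R x k. u $ z * of_real (\<omega> y - shell_weight x \<omega> k))"
    proof (intro sum.cong refl)
      fix y assume y: "y \<in> shell R x k"
      have "u $ y = u $ z"
        using u k y z unfolding shell_constant_def by blast
      then show "u $ y * of_real (\<omega> y - shell_average x \<omega> y) = u $ z * of_real (\<omega> y - shell_weight x \<omega> k)"
        using k y by (simp add: shell_average_eq)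
    qed
    also have "\<dots> = u $ z * of_real ((\<Sum>y\<in>shell R x k. \<omega> y) - card (shell R x k) * shell_weight x \<omega> k)"
      by (simp add: sum_distrib_left[symmetric] sum_subtractf)
    also have "\<dots> = 0"
      using False by (simp add: shell_weight_def)
    finally show ?thesis .
  qed simp
qed

end

section \<open>Primitive idempotents\<close>

locale q_polynomial_scheme = scheme n R
  for n :: nat and R :: "nat \<Rightarrow> ('x::finite \<times> 'x) set" +
  fixes E :: "nat \<Rightarrow> 'x cmatrix"
  assumes Q_polynomial: "Q_polynomial n R E"
begin

lemma E_range: "E ` {..n} = {P. primitive_idempotent \<A> P}" and E_inj: "inj_on E {..n}"
  and E_beyond: "i > n \<Longrightarrow> E i = 0"
  and E_0: "E 0 = mscale (1 / of_nat CARD('x)) all_ones"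
  using Q_polynomial by (auto simp: Q_polynomial_def idempotent_ordering_def bij_betw_def)

lemma E_primitive: "i \<le> n \<Longrightarrow> primitive_idempotent \<A> (E i)"
  using E_range by blast

lemma E_in_adjacency_algebra: "E i \<in> \<A>"
  using E_primitive[of i] E_beyond[of i] cmat.subspace_0[OF subspace_adjacency_algebra]
  by (cases "i \<le> n") (auto simp: primitive_idempotent_def)

lemma E_symmetric: "E i $ y $ z = E i $ z $ y"
  by (rule adjacency_algebra_symmetric[OF E_in_adjacency_algebra])

lemma E_real: "cnj (E i $ y $ z) = E i $ y $ z"
  using E_primitive[of i] E_beyond[of i] primitive_idempotent_real[of "E i"]
  by (cases "i \<le> n") auto

lemma E_hermitian: "conj_transpose (E i) = E i"
  by (simp add: vec_eq_iff E_real E_symmetric)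

lemma E_idempotent: "E i ** E i = E i"
  using E_primitive[of i] E_beyond[of i]
  by (cases "i \<le> n") (auto simp: primitive_idempotent_def matrix_mult_zero_left)

lemma E_orthogonal:
  assumes "i \<noteq> j"
  shows "E i ** E j = 0"
proof (cases "i \<le> n \<and> j \<le> n")
  case True
  then show ?thesis
    using assms E_inj by (intro primitive_idempotent_orthogonal E_primitive) (auto dest: inj_onD)
next
  case False
  then show ?thesis
    using E_beyond[of i] E_beyond[of j] by (auto simp: matrix_mult_zero_left matrix_mult_zero_right)
qed

lemma E_mult: "E i ** E j = (if i = j then E i else 0)"
  by (simp add: E_idempotent E_orthogonal)

text \<open>Multiplying a vanishing combination by \<open>E j\<close> isolates the coefficient of
  \<open>E j\<close>.\<close>

lemma E_independent: "cmat.independent (E ` {..n})"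
proof (rule cmat.independent_if_scalars_zero)
  fix f :: "'x cmatrix \<Rightarrow> complex" and P
  assume 0: "(\<Sum>Q\<in>E ` {..n}. mscale (f Q) Q) = 0" and "P \<in> E ` {..n}"
  then obtain j where j: "j \<le> n" "P = E j"
    by auto
  have "0 = (\<Sum>i\<le>n. mscale (f (E i)) (E i)) ** E j"
    using 0 E_inj by (simp add: sum.reindex matrix_mult_zero_left)
  also have "\<dots> = (\<Sum>i\<le>n. if i = j then mscale (f (E j)) (E j) else 0)"
    unfolding matrix_sum_left mscale_mult_left E_mult by (intro sum.cong) auto
  also have "\<dots> = mscale (f (E j)) (E j)"
    using j by simp
  finally show "f P = 0"
    using E_primitive[OF j(1)] j(2) by (auto simp: primitive_idempotent_def)
qed simp

text \<open>The \<open>n + 1\<close> independent matrices \<open>E i\<close> span the adjacency algebra, which has \<open>n + 1\<close>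
  generators; so the identity is a combination of them.\<close>

lemma sum_E: "(\<Sum>i\<le>n. E i) = mat 1"
proof -
  have "mat 1 \<in> cmat.span (E ` {..n})"
  proof (rule ccontr)
    assume notin: "mat 1 \<notin> cmat.span (E ` {..n})"
    then have notin': "mat 1 \<notin> E ` {..n}"
      using cmat.span_superset[of "E ` {..n}"] by (meson subsetD)
    let ?gens = "(\<lambda>i. adj_matrix (R i)) ` {..n}"
    have "cmat.independent (insert (mat 1) (E ` {..n}))"
      using notin E_independent by (rule cmat.independent_insertI)
    moreover have "insert (mat 1) (E ` {..n}) \<subseteq> cmat.span ?gens"
      using one_in_adjacency_algebra E_in_adjacency_algebra by (auto simp: adjacency_algebra_def)
    ultimately have "card (insert (mat 1) (E ` {..n})) \<le> card ?gens"
      using cmat.independent_span_bound[of ?gens] by auto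
    moreover have "card ?gens \<le> n + 1"
      using card_image_le[of "{..n}"] by fastforce
    moreover have "card (insert (mat 1) (E ` {..n})) = n + 2"
      using notin' E_inj by (simp add: card_image)
    ultimately show False by simp
  qed
  \<comment> \<open>Multiplication by the sum fixes each \<open>E i\<close>, hence their whole span,
    which contains the identity matrix.\<close>
  then have "mat 1 ** (\<Sum>i\<le>n. E i) = mat 1"
  proof (rule cmat.span_induct[where P = "\<lambda>N. N ** (\<Sum>i\<le>n. E i) = N"])
    show "cmat.subspace {N. N ** (\<Sum>i\<le>n. E i) = N}"
      by (simp add: cmat.subspace_def matrix_mult_zero_left matrix_add_rdistrib mscale_mult_left)
    show "N ** (\<Sum>i\<le>n. E i) = N" if "N \<in> E ` {..n}" for N
      using that by (auto simp: matrix_sum_right E_mult)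
  qed
  then show ?thesis by simp
qed

section \<open>Entrywise products\<close>

text \<open>For the entrywise product these are the polynomials of degree at most \<open>m\<close>
  in \<open>E 1\<close>.\<close>

abbreviation "U m \<equiv> cmat.span (E ` {..m})"

lemma U_mono: "i \<le> j \<Longrightarrow> U i \<subseteq> U j"
  by (intro cmat.span_mono image_mono) auto

lemma E_in_U: "i \<le> m \<Longrightarrow> E i \<in> U m"
  by (intro cmat.span_base) auto

lemma hadamard_subspace: "cmat.subspace {N. hadamard M N \<in> U m}"
proof (rule cmat.subspaceI)
  have "hadamard M 0 = 0"
    by (simp add: vec_eq_iff)
  then show "0 \<in> {N. hadamard M N \<in> U m}"
    by (simp add: cmat.span_zero)
next
  fix N P assume "N \<in> {N. hadamard M N \<in> U m}" "P \<in> {N. hadamard M N \<in> U m}"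
  moreover have "hadamard M (N + P) = hadamard M N + hadamard M P"
    by (simp add: vec_eq_iff algebra_simps)
  ultimately show "N + P \<in> {N. hadamard M N \<in> U m}"
    by (simp add: cmat.span_add)
next
  fix c N assume "N \<in> {N. hadamard M N \<in> U m}"
  moreover have "hadamard M (mscale c N) = mscale c (hadamard M N)"
    by (simp add: vec_eq_iff)
  ultimately show "mscale c N \<in> {N. hadamard M N \<in> U m}"
    by (simp add: cmat.span_scale)
qed

text \<open>The Q-polynomial relation entry by entry, with the denominator cleared. The sequence
  \<open>b\<close> is shifted by one, so that all coefficients at step \<open>i\<close> avoid
  truncated subtraction.\<close>

lemma three_term_recurrence:
  obtains a b c :: "nat \<Rightarrow> real"
  where "\<And>i. i < n \<Longrightarrow> c (Suc i) \<noteq> 0"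
    and "\<And>i y z. i \<le> n \<Longrightarrow> of_nat CARD('x) * (E 1 $ y $ z * E i $ y $ z) =
      (if i = 0 then 0 else of_real (b i) * E (i - 1) $ y $ z) +
      of_real (a i) * E i $ y $ z + of_real (c (Suc i)) * E (Suc i) $ y $ z"
proof -
  obtain a b c :: "nat \<Rightarrow> real" where nz: "\<forall>i\<in>{1..n}. b (i - 1) * c i \<noteq> 0"
    and eq: "\<forall>i\<le>n. hadamard (E 1) (E i) =
           mscale (1 / of_nat CARD('x))
             ((if i = 0 then 0 else mscale (of_real (b (i - 1))) (E (i - 1))) +
              mscale (of_real (a i)) (E i) +
              mscale (of_real (c (i + 1))) (E (i + 1)))"
    using Q_polynomial unfolding Q_polynomial_def by blast
  show thesis
  proof (rule that[of c "\<lambda>i. b (i - 1)" a])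
    show "c (Suc i) \<noteq> 0" if "i < n" for i
      using bspec[OF nz, of "Suc i"] that by simp
    fix i y z assume i: "i \<le> n"
    have "E 1 $ y $ z * E i $ y $ z = hadamard (E 1) (E i) $ y $ z"
      by simp
    then show "of_nat CARD('x) * (E 1 $ y $ z * E i $ y $ z) =
      (if i = 0 then 0 else of_real (b (i - 1)) * E (i - 1) $ y $ z) +
      of_real (a i) * E i $ y $ z + of_real (c (Suc i)) * E (Suc i) $ y $ z"
      unfolding eq[rule_format, OF i] by simp
  qed
qed

lemma hadamard_E1:
  assumes "N \<in> U m"
  shows "hadamard (E 1) N \<in> U (Suc m)"
proof -
  obtain a b c :: "nat \<Rightarrow> real" where eq: "\<And>i y z. i \<le> n \<Longrightarrow>
      of_nat CARD('x) * (E 1 $ y $ z * E i $ y $ z) =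
      (if i = 0 then 0 else of_real (b i) * E (i - 1) $ y $ z) +
      of_real (a i) * E i $ y $ z + of_real (c (Suc i)) * E (Suc i) $ y $ z"
    by (rule three_term_recurrence) blast
  have "hadamard (E 1) (E i) \<in> U (Suc m)" if "i \<le> m" for i
  proof (cases "i \<le> n")
    case True
    have "hadamard (E 1) (E i) = mscale (1 / of_nat CARD('x))
        (mscale (if i = 0 then 0 else of_real (b i)) (E (i - 1)) +
         mscale (of_real (a i)) (E i) + mscale (of_real (c (Suc i))) (E (Suc i)))"
      using eq[OF True] by (simp add: vec_eq_iff field_simps)
    also have "\<dots> \<in> U (Suc m)"
      using that by (intro cmat.span_scale cmat.span_add E_in_U) auto
    finally show ?thesis .
  next
    case False
    then have "hadamard (E 1) (E i) = 0"
      by (simp add: E_beyond vec_eq_iff)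
    then show ?thesis by (simp add: cmat.span_zero)
  qed
  then show ?thesis
    by (intro cmat.span_induct[where P = "\<lambda>N. hadamard (E 1) N \<in> U (Suc m)", OF assms hadamard_subspace])
      auto
qed

text \<open>As \<open>c (Suc k)\<close> is nonzero, the recurrence can be solved for
  \<open>E (Suc k)\<close> in terms of \<open>E k\<close> and \<open>E (k - 1)\<close>. Only the
  product with \<open>E 1\<close> raises the degree, and by at most one; strong induction covers
  both earlier indices.\<close>

lemma hadamard_E: "hadamard (E i) (E j) \<in> U (i + j)"
proof (induction i rule: less_induct)
  case (less i)
  consider "i = 0" | "i > n" | k where "i = Suc k" "k < n"
    by (metis not_less_eq not_less_iff_gr_or_eq gr0_conv_Suc)
  then show ?case
  proof cases
    case 1
    have "hadamard (E 0) (E j) = mscale (1 / of_nat CARD('x)) (E j)"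
      by (simp add: vec_eq_iff E_0 all_ones_def)
    then show ?thesis using 1 by (simp add: cmat.span_scale E_in_U)
  next
    case 2
    then have "hadamard (E i) (E j) = 0"
      by (simp add: E_beyond vec_eq_iff)
    then show ?thesis by (simp add: cmat.span_zero)
  next
    case 3
    obtain a b c :: "nat \<Rightarrow> real" where c: "\<And>i. i < n \<Longrightarrow> c (Suc i) \<noteq> 0"
      and eq: "\<And>i y z. i \<le> n \<Longrightarrow>
        of_nat CARD('x) * (E 1 $ y $ z * E i $ y $ z) =
        (if i = 0 then 0 else of_real (b i) * E (i - 1) $ y $ z) +
        of_real (a i) * E i $ y $ z + of_real (c (Suc i)) * E (Suc i) $ y $ z"
      by (rule three_term_recurrence) blast
    \<comment> \<open>For \<open>k = 0\<close> the index \<open>k - 1\<close> truncates to 0; the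
      zero coefficient removes that spurious term.\<close>
    let ?\<beta> = "if k = 0 then 0 else complex_of_real (b k)"
    have "hadamard (E i) (E j) = mscale (1 / of_real (c i))
        (mscale (of_nat CARD('x)) (hadamard (E 1) (hadamard (E k) (E j)))
          - mscale ?\<beta> (hadamard (E (k - 1)) (E j)) - mscale (of_real (a k)) (hadamard (E k) (E j)))"
    proof -
      have "of_real (c i) * E i $ y $ z = of_nat CARD('x) * (E 1 $ y $ z * E k $ y $ z)
          - ?\<beta> * E (k - 1) $ y $ z - of_real (a k) * E k $ y $ z" for y z
        using eq[of k y z] 3 by simp
      then have entry: "E i $ y $ z = (of_nat CARD('x) * (E 1 $ y $ z * E k $ y $ z)
          - ?\<beta> * E (k - 1) $ y $ z - of_real (a k) * E k $ y $ z) / of_real (c i)" for y z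
        using c[of k] 3 by (metis nonzero_mult_div_cancel_left of_real_eq_0_iff)
      show ?thesis
        by (simp add: vec_eq_iff entry algebra_simps diff_divide_distrib add_divide_distrib)
    qed
    also have "\<dots> \<in> U (i + j)"
    proof (intro cmat.span_scale cmat.span_diff)
      have "hadamard (E 1) (hadamard (E k) (E j)) \<in> U (Suc (k + j))"
        using 3 by (intro hadamard_E1 less.IH) simp
      then show "hadamard (E 1) (hadamard (E k) (E j)) \<in> U (i + j)"
        using 3 by simp
      show "hadamard (E (k - 1)) (E j) \<in> U (i + j)"
        using 3 by (intro subsetD[OF U_mono less.IH]) auto
      show "hadamard (E k) (E j) \<in> U (i + j)"
        using 3 by (intro subsetD[OF U_mono less.IH]) auto
    qed
    finally show ?thesis .
  qed
qed

text \<open>The orthogonal projection onto the sum of the ranges of \<open>E 0\<close>, ...,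
  \<open>E e\<close>.\<close>

definition E_upto :: "nat \<Rightarrow> 'x cmatrix" where
  "E_upto e = (\<Sum>i\<le>e. E i)"

lemma E_upto_in_adjacency_algebra: "E_upto e \<in> \<A>"
  unfolding E_upto_def
  by (intro cmat.subspace_sum subspace_adjacency_algebra E_in_adjacency_algebra)

lemma E_upto_symmetric: "E_upto e $ y $ z = E_upto e $ z $ y"
  by (rule adjacency_algebra_symmetric[OF E_upto_in_adjacency_algebra])

lemma E_upto_hermitian: "conj_transpose (E_upto e) = E_upto e"
  by (simp add: E_upto_def conj_transpose_sum E_hermitian)

lemma E_upto_real: "cnj (E_upto e $ y $ z) = E_upto e $ y $ z"
  by (simp add: E_upto_def E_real)

lemma E_upto_mult_E: "i \<le> e \<Longrightarrow> E_upto e ** E i = E i"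
  by (simp add: E_upto_def matrix_sum_left E_mult)

lemma E_upto_idempotent: "E_upto e ** E_upto e = E_upto e"
  unfolding E_upto_def[of e] matrix_sum_right by (simp add: E_upto_mult_E flip: E_upto_def)

text \<open>The entrywise square expands into products of degree at most \<open>2 * e\<close>, and
  \<open>E k\<close> annihilates every \<open>E i\<close> of smaller index.\<close>

lemma E_hadamard_E_upto:
  assumes "2 * e < k"
  shows "E k ** hadamard (E_upto e) (E_upto e) = 0"
proof -
  have "hadamard (E_upto e) (E_upto e) = (\<Sum>i\<le>e. \<Sum>j\<le>e. hadamard (E i) (E j))"
    by (simp add: vec_eq_iff E_upto_def sum_product)
  also have "\<dots> \<in> U (2 * e)"
    by (intro cmat.span_sum subsetD[OF U_mono hadamard_E]) auto
  finally show ?thesis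
  proof (rule cmat.span_induct[where P = "\<lambda>N. E k ** N = 0"])
    show "cmat.subspace {N. E k ** N = 0}"
      by (simp add: cmat.subspace_def matrix_add_ldistrib mscale_mult_right matrix_mult_zero_right)
    show "E k ** N = 0" if "N \<in> E ` {..2 * e}" for N
      using that assms by (auto simp: E_orthogonal)
  qed
qed

section \<open>Relative designs\<close>

definition deviation :: "'x \<Rightarrow> ('x \<Rightarrow> real) \<Rightarrow> complex ^ 'x" where
  "deviation x \<omega> = (\<chi> y. of_real (\<omega> y - shell_average x \<omega> y))"

text \<open>The vector \<open>u = E\<^sub>k(\<omega> - \<omega>')\<close>, with \<open>\<omega>'\<close> the shell average, is constant on shells while
  \<open>\<omega> - \<omega>'\<close> is orthogonal to all such vectors; so \<open>\<langle>u, u\<rangle> = \<langle>u, \<omega> - \<omega>'\<rangle> = 0\<close>.\<close>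

lemma design_deviation:
  assumes design: "relative_design E x t Y \<omega>" and k: "k \<le> t"
  shows "E k *v deviation x \<omega> = 0"
proof -
  define v :: "complex ^ 'x" where "v = (\<chi> y. of_real (\<omega> y))"
  define u where "u = E k *v deviation x \<omega>"
  \<comment> \<open>The design condition starts at index 1. At index 0 the image is a constant
    vector, because \<open>E 0\<close> is a multiple of the all-ones matrix.\<close>
  have "shell_constant x (E k *v v)"
  proof (cases "k = 0")
    case True
    then show ?thesis
      by (simp add: shell_constant_def E_0 all_ones_def matrix_vector_nth)
  next
    case False
    then have "E k *v v \<in> vec.span {E k *v axis x 1}"
      using design k unfolding relative_design_def v_def by simp
    then obtain c where "E k *v v = c *s (E k *v axis x 1)"
      unfolding vec.span_singleton by blast
    then show ?thesis
      by (simp add: shell_constant_scale shell_constant_mult E_in_adjacency_algebra shell_constant_axis)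
  qed
  moreover have "shell_constant x (E k *v (\<chi> y. of_real (shell_average x \<omega> y)))"
    by (intro shell_constant_mult E_in_adjacency_algebra shell_constant_average)
  moreover have "deviation x \<omega> = v - (\<chi> y. of_real (shell_average x \<omega> y))"
    by (simp add: vec_eq_iff v_def deviation_def)
  ultimately have const: "shell_constant x u"
    by (simp add: u_def matrix_vector_mult_diff_distrib shell_constant_diff)
  have Eu: "E k *v u = u"
    by (simp add: u_def matrix_vector_mul_assoc E_idempotent)
  \<comment> \<open>Only one factor \<open>u\<close> is unfolded; \<open>E k\<close>, being real and
    symmetric, then moves over to the other factor, which it fixes.\<close>
  have "(\<Sum>y\<in>UNIV. of_real 1 * (cnj (u $ y) * u $ y))
      = (\<Sum>y\<in>UNIV. \<Sum>z\<in>UNIV. cnj (u $ y) * (E k $ y $ z * deviation x \<omega> $ z))"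
    by (subst (2) u_def) (simp add: matrix_vector_nth sum_distrib_left)
  also have "\<dots> = (\<Sum>z\<in>UNIV. \<Sum>y\<in>UNIV. cnj (u $ y) * (E k $ y $ z * deviation x \<omega> $ z))"
    by (rule sum.swap)
  also have "\<dots> = (\<Sum>z\<in>UNIV. cnj ((E k *v u) $ z) * deviation x \<omega> $ z)"
    unfolding matrix_vector_nth cnj_sum sum_distrib_right
    by (intro sum.cong refl) (simp add: E_real, metis E_symmetric mult.assoc mult.commute)
  also have "\<dots> = 0"
    using sum_shell_constant_average[OF shell_constant_cnj[OF const], of \<omega>]
    by (simp add: Eu deviation_def)
  finally have "of_real 1 * u $ y = 0" for y
    by (rule sum_cnj_mult_self_eq_0) simp
  then show ?thesis
    by (simp add: vec_eq_iff flip: u_def)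
qed

text \<open>In coordinates of \<open>v\<close> and \<open>u\<close>, each entry is a combination of
  the sums in \<open>triple_product_vanishes\<close>. This carries the degree bound from entrywise
  products of matrices to pointwise products of functions.\<close>

lemma product_in_low_degree:
  assumes "2 * e < k"
  shows "E k *v (\<chi> w. (E_upto e *v v) $ w * (E_upto e *v u) $ w) = 0"
proof -
  have "(E k *v (\<chi> w. (E_upto e *v v) $ w * (E_upto e *v u) $ w)) $ a = 0" for a
  proof -
    have "(E k *v (\<chi> w. (E_upto e *v v) $ w * (E_upto e *v u) $ w)) $ a
        = (\<Sum>w\<in>UNIV. \<Sum>y\<in>UNIV. \<Sum>z\<in>UNIV. v $ y * u $ z * (E k $ a $ w * E_upto e $ w $ y * E_upto e $ w $ z))"
      by (simp add: matrix_vector_nth sum_product sum_distrib_left mult_ac)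
    also have "\<dots> = (\<Sum>y\<in>UNIV. \<Sum>z\<in>UNIV. \<Sum>w\<in>UNIV. v $ y * u $ z * (E k $ a $ w * E_upto e $ w $ y * E_upto e $ w $ z))"
      by (subst sum.swap) (intro sum.cong refl sum.swap)
    also have "\<dots> = 0"
      using triple_product_vanishes[of "E k" "E_upto e" a] assms
      by (simp add: E_hermitian E_idempotent E_upto_hermitian E_upto_idempotent E_hadamard_E_upto E_upto_symmetric
          flip: sum_distrib_left)
    finally show ?thesis .
  qed
  then show ?thesis by (simp add: vec_eq_iff)
qed

text \<open>The deviation is the sum of its components under the \<open>E k\<close>. Those with
  \<open>k \<le> 2 * e\<close> vanish by the design property; the others are orthogonal to the
  product, whose degree is at most \<open>2 * e\<close>.\<close>

lemma design_average:
  assumes design: "relative_design E x (2 * e) Y \<omega>"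
  shows "(\<Sum>y\<in>UNIV. of_real (\<omega> y) * ((E_upto e *v v) $ y * (E_upto e *v u) $ y))
    = (\<Sum>y\<in>UNIV. of_real (shell_average x \<omega> y) * ((E_upto e *v v) $ y * (E_upto e *v u) $ y))"
proof -
  define h :: "complex ^ 'x" where "h = (\<chi> w. (E_upto e *v v) $ w * (E_upto e *v u) $ w)"
  let ?d = "deviation x \<omega>"
  have zero: "(\<Sum>y\<in>UNIV. (E k *v ?d) $ y * h $ y) = 0" for k
  proof (cases "k \<le> 2 * e")
    case True
    then show ?thesis by (simp add: design_deviation[OF design])
  next
    case False
    have "(\<Sum>y\<in>UNIV. (E k *v ?d) $ y * h $ y) = (\<Sum>y\<in>UNIV. \<Sum>z\<in>UNIV. ?d $ z * (E k $ z $ y * h $ y))"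
      unfolding matrix_vector_nth sum_distrib_right
      by (intro sum.cong refl) (simp add: E_symmetric[of k] mult_ac)
    also have "\<dots> = (\<Sum>z\<in>UNIV. ?d $ z * (E k *v h) $ z)"
      by (subst sum.swap) (simp add: matrix_vector_nth sum_distrib_left)
    also have "\<dots> = 0"
      using product_in_low_degree[of e k v u] False by (simp add: h_def)
    finally show ?thesis .
  qed
  have "(\<Sum>y\<in>UNIV. ?d $ y * h $ y) = (\<Sum>y\<in>UNIV. ((\<Sum>k\<le>n. E k) *v ?d) $ y * h $ y)"
    by (simp add: sum_E)
  also have "\<dots> = (\<Sum>y\<in>UNIV. \<Sum>k\<le>n. (E k *v ?d) $ y * h $ y)"
    by (simp add: matrix_vector_sum_left sum_distrib_right)
  also have "\<dots> = 0"
    by (subst sum.swap) (simp add: zero)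
  finally show ?thesis
    by (simp add: deviation_def h_def left_diff_distrib sum_subtractf)
qed

text \<open>Rewrites the space in the tightness condition as the range of one projection, which
  fixes each summand.\<close>

lemma sum_E_range:
  "range (\<lambda>v :: nat \<Rightarrow> complex ^ 'x. \<Sum>i\<le>e. E i *v v i) = range ((*v) (E_upto e))"
proof (intro subset_antisym image_subsetI)
  fix v :: "nat \<Rightarrow> complex ^ 'x"
  have "(\<Sum>i\<le>e. E i *v v i) = (\<Sum>i\<le>e. E_upto e *v (E i *v v i))"
    by (simp add: matrix_vector_mul_assoc E_upto_mult_E)
  also have "\<dots> = E_upto e *v (\<Sum>i\<le>e. E i *v v i)"
    by (simp add: vec.sum)
  finally show "(\<Sum>i\<le>e. E i *v v i) \<in> range ((*v) (E_upto e))"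
    by (rule range_eqI)
next
  fix u :: "complex ^ 'x"
  have "E_upto e *v u = (\<Sum>i\<le>e. E i *v u)"
    by (simp add: E_upto_def matrix_vector_sum_left)
  then show "E_upto e *v u \<in> range (\<lambda>v :: nat \<Rightarrow> complex ^ 'x. \<Sum>i\<le>e. E i *v v i)"
    by (intro range_eqI[where x = "\<lambda>_. u"])
qed

text \<open>The range is closed under conjugation because the projection has real entries. This lets
  \<open>design_average\<close> compare squared norms.\<close>

lemma E_upto_cnj: "E_upto e *v (\<chi> y. cnj (v $ y)) = (\<chi> y. cnj ((E_upto e *v v) $ y))"
  by (simp add: vec_eq_iff matrix_vector_nth E_upto_real)

text \<open>Restriction to \<open>Y\<close> is injective on the space whose dimension enters the bound, because the
  shell average of the weight is positive on the whole support; tightness makes it surjective.\<close>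

lemma tight_interpolation:
  assumes tight: "tight_relative_design n R E x e Y \<omega>" and y: "y \<in> Y"
  obtains v where "\<And>z. z \<in> Y \<Longrightarrow> (E_upto e *v v) $ z = of_bool (z = y)"
proof -
  let ?L = "support_indices n R x Y"
  \<comment> \<open>\<open>H\<close> restricts functions to the shells that meet \<open>Y\<close>
    and has diagonal \<open>c\<close>; \<open>D\<close> restricts them to \<open>Y\<close>.\<close>
  define H where "H = (\<Sum>l\<in>?L. dual_idempotent R x l)"
  define c :: "'x \<Rightarrow> complex" where "c z = (\<Sum>l\<in>?L. of_bool (z \<in> shell R x l))" for z
  define D :: "'x cmatrix" where "D = (\<chi> y z. of_bool (y = z) * of_bool (y \<in> Y))"
  define W where "W = (*v) H ` range ((*v) (E_upto e))"
  have design: "relative_design E x (2 * e) Y \<omega>" and card: "card Y = vec.dim W"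
    using tight by (simp_all add: tight_relative_design_def W_def H_def sum_E_range)
  have nonneg: "\<And>y. 0 \<le> \<omega> y" and Y: "Y = {y. 0 < \<omega> y}"
    using design by (auto simp: relative_design_def weighted_subset_def)
  have D: "(D *v u) $ z = of_bool (z \<in> Y) * u $ z" for u z
    unfolding D_def diagonal_mult_vec by simp
  have H_diag: "H = (\<chi> y z. of_bool (y = z) * c y)"
    by (simp add: vec_eq_iff H_def c_def dual_idempotent_def)
  have H: "(H *v u) $ z = c z * u $ z" for u z
    unfolding H_diag diagonal_mult_vec by simp
  have c_Y: "c z = 1" if "z \<in> Y" for z
  proof -
    obtain k where k: "k \<le> n" "z \<in> shell R x k"
      using shell_exists by blast
    then have kL: "k \<in> ?L"
      using that by (auto simp: support_indices_def)
    have "z \<in> shell R x l \<longleftrightarrow> l = k" if "l \<in> ?L" for l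
      using shell_unique[OF _ k(1) _ k(2)] k(2) that by (auto simp: support_indices_def)
    then have "c z = (\<Sum>l\<in>?L. if l = k then 1 else 0)"
      unfolding c_def by (intro sum.cong) simp_all
    moreover have "finite ?L"
      by (simp add: support_indices_def)
    ultimately show ?thesis using kL by simp
  qed
  have average_pos: "0 < shell_average x \<omega> z" if "c z \<noteq> 0" for z
  proof -
    have "\<exists>l\<in>?L. z \<in> shell R x l"
    proof (rule ccontr)
      assume "\<not> (\<exists>l\<in>?L. z \<in> shell R x l)"
      then have "c z = 0"
        unfolding c_def by (intro sum.neutral) auto
      then show False using that by simp
    qed
    then obtain l y where "l \<le> n" "z \<in> shell R x l" "y \<in> shell R x l" "0 < \<omega> y"
      by (auto simp: support_indices_def Y)
    then show ?thesis
      by (intro shell_average_pos[OF nonneg])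
  qed
  have lin: "Vector_Spaces.linear (*s) (*s) ((*v) D)"
    by simp
  have W: "vec.subspace W"
    unfolding W_def by (intro vec.subspace_image vec.subspace_UNIV)
  have kernel: "w = 0" if "w \<in> W" "D *v w = 0" for w
  proof -
    obtain v where w: "w = H *v (E_upto e *v v)"
      using \<open>w \<in> W\<close> by (auto simp: W_def)
    define f where "f = E_upto e *v v"
    have f_Y: "f $ z = 0" if "z \<in> Y" for z
      using arg_cong[OF \<open>D *v w = 0\<close>, of "\<lambda>u. u $ z"] that by (simp add: D w H c_Y f_def)
    have "of_real (\<omega> z) * f $ z = 0" for z
      using f_Y[of z] nonneg[of z] by (cases "z \<in> Y") (auto simp: Y)
    then have "(\<Sum>z\<in>UNIV. of_real (\<omega> z) * (cnj (f $ z) * f $ z)) = 0"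
      by (intro sum.neutral) auto
    \<comment> \<open>\<open>f\<close> has norm zero for \<omega>, hence also for the shell average,
      so it vanishes on every shell that meets \<open>Y\<close>.\<close>
    then have "(\<Sum>z\<in>UNIV. of_real (shell_average x \<omega> z) * (cnj (f $ z) * f $ z)) = 0"
      using design_average[OF design, of "\<chi> y. cnj (v $ y)" v] by (simp add: E_upto_cnj f_def)
    then have average_f: "of_real (shell_average x \<omega> z) * f $ z = 0" for z
      by (rule sum_cnj_mult_self_eq_0) (rule shell_average_nonneg[OF nonneg])
    have "c z * f $ z = 0" for z
      using average_f[of z] average_pos[of z] by (cases "c z = 0") auto
    then show ?thesis
      by (simp add: vec_eq_iff w H f_def)
  qed
  have inj: "inj_on ((*v) D) W"
  proof (rule inj_onI)
    fix a b assume ab: "a \<in> W" "b \<in> W" "D *v a = D *v b"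
    have "a - b = 0"
      by (rule kernel) (simp_all add: ab vec.subspace_diff[OF W] matrix_vector_mult_diff_distrib)
    then show "a = b" by simp
  qed
  \<comment> \<open>The image of \<open>W\<close> under \<open>D\<close> lies in the span of these
    at most \<open>card Y\<close> vectors and has dimension \<open>card Y\<close> itself, so the two
    spaces coincide.\<close>
  let ?B = "(\<lambda>y. axis y (1::complex)) ` Y"
  have "inj_on ((*v) D) (vec.span W)"
    using inj W vec.span_eq_iff by metis
  then have dim: "vec.dim ((*v) D ` W) = card Y"
    using vec.dim_image_eq[OF lin] card by simp
  have "(*v) D ` W = vec.span ?B"
  proof (rule vec.subspace_dim_equal)
    show "vec.subspace ((*v) D ` W)"
      by (intro vec.subspace_image W)
    show "vec.subspace (vec.span ?B)"
      by (rule vec.subspace_span)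
    show "(*v) D ` W \<subseteq> vec.span ?B"
    proof (rule image_subsetI)
      fix w :: "complex ^ 'x"
      have "(\<Sum>y\<in>Y. w $ y * axis y 1 $ z) = (\<Sum>y\<in>Y. if y = z then w $ z else 0)" for z
        by (intro sum.cong) (auto simp: axis_def)
      then have "D *v w = (\<Sum>y\<in>Y. w $ y *s axis y 1)"
        by (simp add: vec_eq_iff D)
      also have "\<dots> \<in> vec.span ?B"
        by (intro vec.span_sum vec.span_scale vec.span_base) auto
      finally show "D *v w \<in> vec.span ?B" .
    qed
    have "vec.dim ?B \<le> card ?B"
      by (intro vec.dim_le_card') simp
    also have "\<dots> \<le> card Y"
      by (intro card_image_le) simp
    finally show "vec.dim (vec.span ?B) \<le> vec.dim ((*v) D ` W)"
      by (simp add: dim vec.dim_span)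
  qed
  moreover have "axis y 1 \<in> vec.span ?B"
    using y by (intro vec.span_base) simp
  ultimately obtain v where v: "axis y 1 = D *v (H *v (E_upto e *v v))"
    unfolding W_def by blast
  show thesis
  proof (rule that)
    fix z assume "z \<in> Y"
    then show "(E_upto e *v v) $ z = of_bool (z = y)"
      using arg_cong[OF v, of "\<lambda>u. u $ z"] by (auto simp: D H c_Y axis_def split: if_splits)
  qed
qed

text \<open>\<open>K\<close> is the reproducing kernel of the range of \<open>E_upto e\<close> for the inner product weighted by the
  shell average; with \<open>X\<close> a generalised inverse of the Gram matrix \<open>G\<close>, it is \<open>E_upto e ** X ** E_upto e\<close>.\<close>

lemma reproducing_kernel:
  assumes C: "matrix_subalgebra \<C>" and gen: "\<A> \<subseteq> \<C>" "\<And>k. k \<le> n \<Longrightarrow> dual_idempotent R x k \<in> \<C>"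
    and nonneg: "\<And>y. 0 \<le> \<omega> y"
  obtains K where "K \<in> \<C>" and "\<And>y. \<exists>r. \<forall>z. K $ y $ z = (E_upto e *v r) $ z"
    and "\<And>y v. 0 < shell_average x \<omega> y \<Longrightarrow>
      (\<Sum>z\<in>UNIV. of_real (shell_average x \<omega> z) * (K $ y $ z * (E_upto e *v v) $ z)) = (E_upto e *v v) $ y"
proof -
  let ?a = "shell_average x \<omega>"
  have mult: "A ** B \<in> \<C>" if "A \<in> \<C>" "B \<in> \<C>" for A B
    using C that by (simp add: matrix_subalgebra_def)
  have sub: "cmat.subspace \<C>"
    using C by (simp add: matrix_subalgebra_def)
  have MC: "E_upto e \<in> \<C>"
    using E_upto_in_adjacency_algebra gen(1) by blast
  \<comment> \<open>The diagonal matrix of the shell average, the weight of the inner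
    product.\<close>
  define D :: "'x cmatrix" where "D = (\<chi> y z. of_bool (y = z) * of_real (?a y))"
  have "D = (\<Sum>k\<le>n. mscale (of_real (shell_weight x \<omega> k)) (dual_idempotent R x k))"
    by (simp add: vec_eq_iff D_def dual_idempotent_def shell_average_def mult.commute of_bool_conj)
  also have "\<dots> \<in> \<C>"
    using gen(2) by (intro cmat.subspace_sum cmat.subspace_scale sub) simp
  finally have DC: "D \<in> \<C>" .
  have D: "(D *v u) $ z = of_real (?a z) * u $ z" for u z
    unfolding D_def diagonal_mult_vec by simp
  have D_herm: "conj_transpose D = D"
    by (simp add: vec_eq_iff D_def)
  define G where "G = E_upto e ** D ** E_upto e"
  have "G \<in> \<C>" "conj_transpose G = G"
    by (simp_all add: G_def mult MC DC conj_transpose_mult E_upto_hermitian D_herm matrix_mul_assoc)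
  then obtain X where X: "X \<in> \<C>" "G ** X ** G = G"
    using hermitian_regular[OF C] by blast
  show thesis
  proof (rule that)
    show "E_upto e ** X ** E_upto e \<in> \<C>"
      by (intro mult MC X)
    show "\<exists>r. \<forall>z. (E_upto e ** X ** E_upto e) $ y $ z = (E_upto e *v r) $ z" for y
    proof (intro exI allI)
      fix z
      \<comment> \<open>Since \<open>E_upto e\<close> is symmetric, row \<open>y\<close> of the
        kernel is its image of row \<open>y\<close> of \<open>E_upto e ** X\<close>.\<close>
      show "(E_upto e ** X ** E_upto e) $ y $ z = (E_upto e *v (\<chi> b. (E_upto e ** X) $ y $ b)) $ z"
        unfolding matrix_mult_nth[of "E_upto e ** X"] matrix_vector_nth
        by (intro sum.cong refl) (simp add: E_upto_symmetric[of e z] mult.commute)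
    qed
  next
    fix y v assume pos: "0 < ?a y"
    \<comment> \<open>\<open>G ** X ** G = G\<close> puts \<open>q\<close> in the kernel of
      \<open>G\<close>. The weighted squared norm of \<open>f\<close> is the value at
      \<open>q\<close> of the Hermitian form of \<open>G\<close>, hence zero, so \<open>f\<close>
      vanishes where the weight is positive.\<close>
    define q where "q = X *v (G *v v) - v"
    define f where "f = E_upto e *v q"
    have Gq: "G *v q = 0"
      by (simp add: q_def matrix_vector_mult_diff_distrib matrix_vector_mul_assoc X matrix_mul_assoc)
    have "(\<Sum>z\<in>UNIV. of_real (?a z) * (cnj (f $ z) * f $ z))
        = (\<Sum>z\<in>UNIV. \<Sum>b\<in>UNIV. cnj (E_upto e $ z $ b * q $ b) * (D *v f) $ z)"
      unfolding D by (subst f_def) (simp add: matrix_vector_nth sum_distrib_left sum_distrib_right mult_ac)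
    also have "\<dots> = (\<Sum>b\<in>UNIV. \<Sum>z\<in>UNIV. cnj (E_upto e $ z $ b * q $ b) * (D *v f) $ z)"
      by (rule sum.swap)
    also have "\<dots> = (\<Sum>b\<in>UNIV. cnj (q $ b) * (E_upto e *v (D *v f)) $ b)"
      unfolding matrix_vector_nth[of "E_upto e" "D *v f"] sum_distrib_left
      by (intro sum.cong refl) (simp add: E_upto_real E_upto_symmetric[of e] mult_ac)
    also have "E_upto e *v (D *v f) = G *v q"
      by (simp add: f_def G_def matrix_vector_mul_assoc matrix_mul_assoc)
    also have "(\<Sum>b\<in>UNIV. cnj (q $ b) * (G *v q) $ b) = 0"
      by (simp add: Gq)
    finally have "of_real (?a y) * f $ y = 0"
      by (rule sum_cnj_mult_self_eq_0) (rule shell_average_nonneg[OF nonneg])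
    then have f0: "f $ y = 0"
      using pos by simp
    have "(\<Sum>z\<in>UNIV. of_real (?a z) * ((E_upto e ** X ** E_upto e) $ y $ z * (E_upto e *v v) $ z))
        = ((E_upto e ** X ** E_upto e) *v (D *v (E_upto e *v v))) $ y"
      unfolding matrix_vector_nth[of "E_upto e ** X ** E_upto e"] D by (simp add: mult_ac)
    also have "(E_upto e ** X ** E_upto e) *v (D *v (E_upto e *v v)) = E_upto e *v (X *v (G *v v))"
      by (simp add: G_def matrix_vector_mul_assoc matrix_mul_assoc)
    \<comment> \<open>The kernel reproduces \<open>E_upto e *v v\<close> up to the error
      \<open>f\<close>, which is zero at \<open>y\<close>.\<close>
    also have "\<dots> = f + E_upto e *v v"
      by (simp add: f_def q_def matrix_vector_mult_diff_distrib)
    finally show "(\<Sum>z\<in>UNIV. of_real (?a z) * ((E_upto e ** X ** E_upto e) $ y $ z * (E_upto e *v v) $ z)) = (E_upto e *v v) $ y"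
      by (simp add: f0)
  qed
qed

end

section \<open>The weight as the reciprocal of the kernel diagonal\<close>

theorem theorem3p14:
  fixes R :: "nat \<Rightarrow> ('x::finite \<times> 'x) set"
    and E :: "nat \<Rightarrow> complex ^ 'x ^ 'x"
    and \<omega> :: "'x \<Rightarrow> real"
    and n e l :: nat and x :: 'x and Y :: "'x set"
  assumes "association_scheme n R"
    and "Q_polynomial n R E"
    and "e \<ge> 1"
    and "tight_relative_design n R E x e Y \<omega>"
    and "l \<in> support_indices n R x Y"
    and "is_fiber (coherent_closure (terwilliger_algebra n R x)) (shell R x l)"
  shows "\<omega> constant_on (Y \<inter> shell R x l)"
proof -
  interpret q_polynomial_scheme n R E
    by unfold_locales (fact assms)+
  let ?C = "coherent_closure (terwilliger_algebra n R x)"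
  have design: "relative_design E x (2 * e) Y \<omega>"
    using assms(4) by (simp add: tight_relative_design_def)
  then have nonneg: "\<And>y. 0 \<le> \<omega> y" and Y: "Y = {y. 0 < \<omega> y}"
    by (auto simp: relative_design_def weighted_subset_def)
  have C: "matrix_subalgebra ?C"
    using coherent_algebra_closure[of "terwilliger_algebra n R x"] by (simp add: coherent_algebra_def)
  have AC: "\<A> \<subseteq> ?C"
    unfolding adjacency_algebra_def
    using C by (intro cmat.span_minimal)
      (auto simp: matrix_subalgebra_def intro: generator_in_coherent_closure)
  have dual: "dual_idempotent R x k \<in> ?C" if "k \<le> n" for k
    using that by (intro generator_in_coherent_closure) simp
  obtain K where K: "K \<in> ?C"
    and row: "\<And>y. \<exists>r. \<forall>z. K $ y $ z = (E_upto e *v r) $ z"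
    and repr: "\<And>y v. 0 < shell_average x \<omega> y \<Longrightarrow>
      (\<Sum>z\<in>UNIV. of_real (shell_average x \<omega> z) * (K $ y $ z * (E_upto e *v v) $ z)) = (E_upto e *v v) $ y"
    by (rule reproducing_kernel[where x = x and \<omega> = \<omega> and e = e, OF C AC dual nonneg]) (assumption, rule that)
  have diagonal: "of_real (\<omega> y) * K $ y $ y = 1" if y: "y \<in> Y" for y
  proof -
    obtain v where v: "\<And>z. z \<in> Y \<Longrightarrow> (E_upto e *v v) $ z = of_bool (z = y)"
      using tight_interpolation[OF assms(4) y] by blast
    \<comment> \<open>Row \<open>y\<close> of \<open>K\<close> belongs to the range of
      \<open>E_upto e\<close>, so \<open>design_average\<close> applies to its product with the
      interpolating function.\<close>
    obtain r where r: "\<And>z. K $ y $ z = (E_upto e *v r) $ z"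
      using row by blast
    obtain k where "k \<le> n" "y \<in> shell R x k"
      using shell_exists by blast
    then have pos: "0 < shell_average x \<omega> y"
      using y Y by (intro shell_average_pos[OF nonneg]) auto
    have "of_real (\<omega> y) * K $ y $ y
        = (\<Sum>z\<in>UNIV. if z = y then of_real (\<omega> y) * K $ y $ y else 0)"
      by simp
    \<comment> \<open>Off \<open>Y\<close> the weight is zero, and on \<open>Y\<close> the
      interpolating function is the indicator of \<open>y\<close>.\<close>
    also have "\<dots> = (\<Sum>z\<in>UNIV. of_real (\<omega> z) * (K $ y $ z * (E_upto e *v v) $ z))"
    proof (intro sum.cong refl)
      fix z
      show "(if z = y then of_real (\<omega> y) * K $ y $ y else 0)
          = of_real (\<omega> z) * (K $ y $ z * (E_upto e *v v) $ z)"
        using v[of z] y nonneg[of z] by (cases "z \<in> Y") (auto simp: Y)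
    qed
    also have "\<dots> = (\<Sum>z\<in>UNIV. of_real (shell_average x \<omega> z) * (K $ y $ z * (E_upto e *v v) $ z))"
      unfolding r by (rule design_average[OF design])
    also have "\<dots> = 1"
      using repr[OF pos] v[OF y] by simp
    finally show ?thesis .
  qed
  show ?thesis
    unfolding constant_on_def
  proof (cases "Y \<inter> shell R x l = {}")
    case False
    then obtain y where y: "y \<in> Y" "y \<in> shell R x l"
      by blast
    have "\<omega> z = \<omega> y" if z: "z \<in> Y" "z \<in> shell R x l" for z
    proof -
      have "K $ z $ z = K $ y $ y"
        using assms(6) K z(2) y(2) by (rule fiber_constant_diagonal)
      \<comment> \<open>The common diagonal entry may be cancelled, since its product with
        \<open>\<omega> y\<close> is 1.\<close>
      moreover have "K $ y $ y \<noteq> 0"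
        using diagonal[OF y(1)] by auto
      ultimately have "complex_of_real (\<omega> z) = of_real (\<omega> y)"
        using diagonal[OF y(1)] diagonal[OF z(1)] by (metis mult_right_cancel)
      then show ?thesis by simp
    qed
    then show "\<exists>c. \<forall>z\<in>Y \<inter> shell R x l. \<omega> z = c" by blast
  qed simp
qed

end
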